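(* Let $n\ge 2$. For every domain $D\subsetneq\mathbb{R}^n$ and all $x,y\in D$, $$\delta_D(x,y)\le u_D(x,y)\le 3\,\delta_D(x,y),$$ and both inequalities are sharp, i.e. the constant $1$ on the left cannot be replaced by any larger constant, and the constant $3$ on the right cannot be replaced by any smaller constant, so that the corresponding inequality holds for all domains $D\subsetneq\mathbb{R}^n$ and all $x,y\in D$.
   Context: A domain is a nonempty open connected set. For a domain $D\subsetneq\mathbb{R}^n$ and $x\in D$, $d(x)$ denotes the Euclidean distance from $x$ to the boundary of $D$ in $\mathbb{R}^n$. The Gromov hyperbolic metric $u_D$ is $$u_D(x,y)=2\log\frac{|x-y|+\max\{d(x),d(y)\}}{\sqrt{d(x)\,d(y)}},\qquad x,y\in D.$$ Let $\overline{\mathbb{R}}^n=\mathbb{R}^n\cup\{\infty\}$. For an open set $D\subset\overline{\mathbb{R}}^n$ whose boundary $\partial D$, taken in $\overline{\mathbb{R}}^n$, has at least two points, the Seittenranta metric is $$\delta_D(x,y)=\log\Bigl(1+\sup_{p,q\in\partial D}|p,x,q,y|\Bigr),\qquad |p,x,q,y|=\frac{|p-q|\,|x-y|}{|p-x|\,|q-y|},$$ with the convention $\frac{|\infty-q|}{|\infty-x|}=1$ (so for $p=\infty\neq q$ the absolute ratio is $|x-y|/|q-y|$, for $q=\infty\ne p$ it is $|x-y|/|p-x|$, and for $p=q$ it is $0$). *)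

theory Defs
  imports "HOL-Analysis.Analysis"
begin

definition proper_domain :: "'a::euclidean_space set \<Rightarrow> bool" where
  "proper_domain D \<longleftrightarrow> D \<noteq> {} \<and> open D \<and> connected D \<and> D \<noteq> UNIV"

definition gromov_metric :: "'a::euclidean_space set \<Rightarrow> 'a \<Rightarrow> 'a \<Rightarrow> real" where
  "gromov_metric D x y =
     2 * ln ((norm (x - y) + max (infdist x (frontier D)) (infdist y (frontier D)))
             / sqrt (infdist x (frontier D) * infdist y (frontier D)))"

text \<open>
  The extended space is modelled as \<^typ>\<open>'a option\<close> with the topology
  \<^term>\<open>Alexandroff_compactification euclidean\<close>, and \<^term>\<open>None\<close> is the point at infinity.
\<close>

definition ext_boundary :: "'a::euclidean_space option set \<Rightarrow> 'a option set" where
  "ext_boundary G = Alexandroff_compactification euclidean frontier_of G"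

text \<open>
  A distance from infinity to a finite point is given the value 1. In an absolute ratio such
  distances occur equally often in the numerator and in the denominator, unless the ratio is 0
  because two points coincide, so this encodes the convention that quotients of two such
  distances are 1. It is not a metric on the extended space.
\<close>

fun ext_dist :: "'a::euclidean_space option \<Rightarrow> 'a option \<Rightarrow> real" where
  "ext_dist (Some a) (Some b) = norm (a - b)"
| "ext_dist None None = 0"
| "ext_dist None (Some b) = 1"
| "ext_dist (Some a) None = 1"

definition abs_ratio ::
  "'a::euclidean_space option \<Rightarrow> 'a option \<Rightarrow> 'a option \<Rightarrow> 'a option \<Rightarrow> real" where
  "abs_ratio p x q y = (ext_dist p q * ext_dist x y) / (ext_dist p x * ext_dist q y)"

text \<open>
  For \<open>x\<close>, \<open>y\<close> in an open set \<open>G\<close> with nonempty boundary the set of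
  ratios is nonempty and bounded, so the real supremum is the genuine one.
\<close>

definition seittenranta_metric ::
  "'a::euclidean_space option set \<Rightarrow> 'a option \<Rightarrow> 'a option \<Rightarrow> real" where
  "seittenranta_metric G x y =
     ln (1 + (SUP (p, q) \<in> ext_boundary G \<times> ext_boundary G. abs_ratio p x q y))"

end

theory Submission
  imports Defs
begin

text \<open>
  Write \<open>t = \<bar>x - y\<bar>\<close>, and let \<open>m\<close>, \<open>k\<close> be the distances of \<open>x\<close>, \<open>y\<close> to the boundary. After
  exponentiating, both inequalities compare \<open>1 + s\<close>, where \<open>s\<close> is the supremum of the absolute
  ratios, with \<open>(t + max m k)\<^sup>2 / (m k)\<close>.

  The left inequality holds for each ratio separately: for finite \<open>p\<close>, \<open>q\<close> with
  \<open>u = \<bar>p - x\<bar>\<close>, \<open>v = \<bar>q - y\<bar>\<close>, the estimate \<open>\<bar>p - q\<bar> \<le> u + t + v\<close> gives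
  \<open>1 + \<bar>p,x,q,y\<bar> \<le> (1 + t/u) (1 + t/v) \<le> (m + t) (k + t) / (m k)\<close>, and a point at infinity only
  removes one of the two factors (\<open>abs_ratio_le\<close>).

  For the right inequality the supremum is bounded below by \<open>t / m\<close>
  (\<open>seittenranta_metric_ge_dist_ratio\<close>): choose \<open>p\<close> as a boundary point nearest to \<open>x\<close>, and \<open>q\<close>
  at least as far from \<open>p\<close> as from \<open>y\<close>. If, say, \<open>m \<le> k\<close>, then \<open>k \<le> m + t\<close>, and these constraints
  already force \<open>(t + k)\<^sup>2 / (m k) \<le> (1 + t/m)\<^sup>3\<close> (\<open>gromov_quotient_le_cube\<close>).

  Both constants are seen to be optimal in the space punctured at the origin, at a unit vector \<open>e\<close>
  and \<open>l e\<close> with \<open>l > 1\<close>. There the Seittenranta metric is \<open>ln l\<close> and the Gromov metric is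
  \<open>2 ln (2 l - 1) - ln l\<close>; their quotient tends to \<open>1\<close> as \<open>l \<rightarrow> \<infinity>\<close> and to \<open>3\<close> as \<open>l \<rightarrow> 1\<close>.
\<close>

section \<open>The extended boundary\<close>

text \<open>
  Neighbourhoods of infinity are the complements of compact sets, so infinity is a limit of \<open>D\<close>
  exactly when no compact set contains \<open>D\<close>. At finite points the compactification has the
  Euclidean topology.
\<close>

lemma ext_boundary_image_Some:
  fixes D :: "'a::euclidean_space set"
  assumes "open D"
  shows "ext_boundary (Some ` D) = Some ` frontier D \<union> (if bounded D then {} else {None})"
proof -
  let ?X = "Alexandroff_compactification (euclidean :: 'a topology)"
  have int: "?X interior_of (Some ` D) = Some ` D"
    using assms by (simp add: interior_of_openin)
  have fin: "Some a \<in> ?X closure_of (Some ` D) \<longleftrightarrow> a \<in> closure D" for a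
  proof
    assume a: "Some a \<in> ?X closure_of (Some ` D)"
    show "a \<in> closure D"
      unfolding closure_iff_nhds_not_empty
    proof (intro allI impI)
      fix A V assume "V \<subseteq> A" "open V" "a \<in> V"
      then have "openin ?X (Some ` V)" "Some a \<in> Some ` V"
        by simp_all
      then have "\<exists>y. y \<in> Some ` D \<and> y \<in> Some ` V"
        using a unfolding in_closure_of by blast
      then show "D \<inter> A \<noteq> {}" using \<open>V \<subseteq> A\<close> by auto
    qed
  next
    assume a: "a \<in> closure D"
    have "\<exists>y. y \<in> Some ` D \<and> y \<in> T" if "Some a \<in> T" "openin ?X T" for T
    proof -
      have "(\<exists>U. open U \<and> T = Some ` U) \<or> (\<exists>C. closed C \<and> T = insert None (Some ` (UNIV - C)))"
        using that(2) unfolding openin_Alexandroff_compactification by auto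
      then have "\<exists>V. open V \<and> a \<in> V \<and> Some ` V \<subseteq> T"
      proof (elim disjE exE conjE)
        fix U assume "open U" "T = Some ` U"
        then show ?thesis using that(1) by (intro exI[of _ U]) auto
      next
        fix C assume "closed C" "T = insert None (Some ` (UNIV - C))"
        then show ?thesis using that(1) by (intro exI[of _ "UNIV - C"]) auto
      qed
      then obtain V where V: "open V" "a \<in> V" "Some ` V \<subseteq> T"
        by blast
      then have "D \<inter> V \<noteq> {}"
        using a by (meson closure_iff_nhds_not_empty order_refl)
      then show ?thesis using V(3) by blast
    qed
    then show "Some a \<in> ?X closure_of (Some ` D)"
      by (auto simp: in_closure_of)
  qed
  have inf: "None \<in> ?X closure_of (Some ` D) \<longleftrightarrow> \<not> bounded D"
  proof
    assume n: "None \<in> ?X closure_of (Some ` D)"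
    show "\<not> bounded D"
    proof
      assume "bounded D"
      let ?T = "insert None (Some ` (UNIV - closure D))"
      have "openin ?X ?T"
        using \<open>bounded D\<close> unfolding openin_Alexandroff_compactification
        by (metis closed_closedin closed_closure compact_closure compactin_euclidean_iff topspace_euclidean)
      then have "\<exists>y. y \<in> Some ` D \<and> y \<in> ?T"
        using n unfolding in_closure_of by blast
      then show False using closure_subset by auto
    qed
  next
    assume nb: "\<not> bounded D"
    have "\<exists>y. y \<in> Some ` D \<and> y \<in> T" if T: "None \<in> T" "openin ?X T" for T
    proof -
      obtain C where C: "compact C" "T = insert None (Some ` (UNIV - C))"
        using T unfolding openin_Alexandroff_compactification by auto
      then have "\<not> D \<subseteq> C"
        using nb bounded_subset compact_imp_bounded by blast
      then show ?thesis using C(2) by auto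
    qed
    then show "None \<in> ?X closure_of (Some ` D)"
      by (auto simp: in_closure_of)
  qed
  have "z \<in> ext_boundary (Some ` D) \<longleftrightarrow> z \<in> Some ` frontier D \<union> (if bounded D then {} else {None})" for z
    using assms by (cases z) (auto simp: ext_boundary_def frontier_of_def int fin inf frontier_def interior_open)
  then show ?thesis by blast
qed

lemma frontier_proper_domain_nonempty:
  "proper_domain D \<Longrightarrow> frontier D \<noteq> {}"
  by (simp add: proper_domain_def frontier_eq_empty)

lemma infdist_frontier_pos:
  assumes "proper_domain D" "x \<in> D"
  shows "0 < infdist x (frontier D)"
proof -
  have "x \<notin> frontier D"
    using assms by (simp add: proper_domain_def frontier_def interior_open)
  then show ?thesis
    using frontier_proper_domain_nonempty[OF assms(1)] infdist_pos_not_in_closed frontier_closed by blast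
qed

lemma infdist_frontier_le:
  "p \<in> frontier D \<Longrightarrow> infdist x (frontier D) \<le> norm (p - x)"
  by (metis infdist_le dist_norm norm_minus_commute)

section \<open>Bounds for the supremum of absolute ratios\<close>

text \<open>
  The bound is independent of \<open>p\<close> and \<open>q\<close>. It thus serves twice: it makes the supremum of the
  ratios a genuine one, and it is the left inequality before taking logarithms.
\<close>

lemma abs_ratio_le:
  fixes D :: "'a::euclidean_space set"
  assumes D: "proper_domain D" and xy: "x \<in> D" "y \<in> D"
    and pq: "p \<in> ext_boundary (Some ` D)" "q \<in> ext_boundary (Some ` D)"
  shows "1 + abs_ratio p (Some x) q (Some y)
    \<le> (1 + norm (x - y) / infdist x (frontier D)) * (1 + norm (x - y) / infdist y (frontier D))"
proof -
  define t where "t = norm (x - y)"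
  define m where "m = infdist x (frontier D)"
  define k where "k = infdist y (frontier D)"
  have pos: "0 < m" "0 < k" "0 \<le> t"
    using infdist_frontier_pos[OF D] xy by (auto simp: m_def k_def t_def)
  have bdry: "z = None \<or> (\<exists>a\<in>frontier D. z = Some a)" if "z \<in> ext_boundary (Some ` D)" for z
    using that D by (auto simp: ext_boundary_image_Some proper_domain_def split: if_splits)
  consider "p = None" "q = None" | b where "p = None" "q = Some b" "b \<in> frontier D"
    | a where "p = Some a" "q = None" "a \<in> frontier D"
    | a b where "p = Some a" "q = Some b" "a \<in> frontier D" "b \<in> frontier D"
    using bdry[OF pq(1)] bdry[OF pq(2)] by auto
  then have "1 + abs_ratio p (Some x) q (Some y) \<le> (1 + t / m) * (1 + t / k)"
  proof cases
    case 1
    then show ?thesis using pos by (simp add: abs_ratio_def field_simps)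
  next
    case 2
    have "k \<le> norm (b - y)" using infdist_frontier_le[OF 2(3)] by (simp add: k_def)
    then have "t / norm (b - y) \<le> t / k" using pos by (simp add: frac_le)
    moreover have "0 \<le> t / m + t / m * (t / k)" using pos by simp
    ultimately show ?thesis using 2 by (simp add: abs_ratio_def t_def[symmetric] algebra_simps)
  next
    case 3
    have "m \<le> norm (a - x)" using infdist_frontier_le[OF 3(3)] by (simp add: m_def)
    then have "t / norm (a - x) \<le> t / m" using pos by (simp add: frac_le)
    moreover have "0 \<le> t / k + t / m * (t / k)" using pos by simp
    ultimately show ?thesis using 3 by (simp add: abs_ratio_def t_def[symmetric] algebra_simps)
  next
    case 4
    define u where "u = norm (a - x)"
    define v where "v = norm (b - y)"
    have u: "m \<le> u" using infdist_frontier_le[OF 4(3)] by (simp add: m_def u_def)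
    have v: "k \<le> v" using infdist_frontier_le[OF 4(4)] by (simp add: k_def v_def)
    have "norm (a - b) \<le> u + t + v"
      using norm_triangle_ineq[of "a - x" "x - y"] norm_triangle_ineq[of "a - y" "y - b"]
      by (simp add: u_def v_def t_def norm_minus_commute)
    then have "norm (a - b) * t \<le> (u + t + v) * t"
      using pos by (intro mult_right_mono) auto
    then have "norm (a - b) * t / (u * v) \<le> (u + t + v) * t / (u * v)"
      using u v pos by (intro divide_right_mono) auto
    then have "1 + norm (a - b) * t / (u * v) \<le> 1 + (u + t + v) * t / (u * v)"
      by simp
    also have "\<dots> = (1 + t / u) * (1 + t / v)"
      using u v pos by (simp add: field_simps)
    also have "\<dots> \<le> (1 + t / m) * (1 + t / k)"
      using u v pos by (intro mult_mono add_left_mono frac_le) auto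
    finally show ?thesis using 4 by (simp add: abs_ratio_def u_def v_def t_def)
  qed
  then show ?thesis by (simp add: t_def m_def k_def)
qed

lemma ext_boundary_nonempty:
  "proper_domain D \<Longrightarrow> ext_boundary (Some ` D) \<noteq> {}"
  using frontier_proper_domain_nonempty by (auto simp: ext_boundary_image_Some proper_domain_def)

lemma abs_ratio_nonneg: "0 \<le> abs_ratio p x q y"
proof -
  have "0 \<le> ext_dist r s" for r s :: "'a option"
    by (cases "(r, s)" rule: ext_dist.cases) auto
  then show ?thesis by (simp add: abs_ratio_def)
qed

lemma abs_ratio_le_Sup:
  assumes "proper_domain D" "x \<in> D" "y \<in> D"
    "p \<in> ext_boundary (Some ` D)" "q \<in> ext_boundary (Some ` D)"
  shows "abs_ratio p (Some x) q (Some y)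
    \<le> (SUP (p, q) \<in> ext_boundary (Some ` D) \<times> ext_boundary (Some ` D). abs_ratio p (Some x) q (Some y))"
proof -
  have "bdd_above ((\<lambda>(p, q). abs_ratio p (Some x) q (Some y)) `
      (ext_boundary (Some ` D) \<times> ext_boundary (Some ` D)))"
  proof (rule bdd_aboveI2, clarify)
    fix p q assume "p \<in> ext_boundary (Some ` D)" "q \<in> ext_boundary (Some ` D)"
    then show "abs_ratio p (Some x) q (Some y)
        \<le> (1 + norm (x - y) / infdist x (frontier D)) * (1 + norm (x - y) / infdist y (frontier D)) - 1"
      using abs_ratio_le[OF assms(1-3)] by (simp add: le_diff_eq add.commute)
  qed
  moreover have "(p, q) \<in> ext_boundary (Some ` D) \<times> ext_boundary (Some ` D)"
    using assms(4,5) by simp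
  ultimately show ?thesis
    by (metis (no_types, lifting) cSUP_upper case_prod_conv)
qed

lemma seittenranta_metric_geI:
  assumes "proper_domain D" "x \<in> D" "y \<in> D"
    "p \<in> ext_boundary (Some ` D)" "q \<in> ext_boundary (Some ` D)"
    and "0 \<le> s" "s \<le> abs_ratio p (Some x) q (Some y)"
  shows "ln (1 + s) \<le> seittenranta_metric (Some ` D) (Some x) (Some y)"
  unfolding seittenranta_metric_def
  using abs_ratio_le_Sup[OF assms(1-5)] assms(6,7) by (intro ln_mono) auto

lemma seittenranta_metric_leI:
  assumes D: "proper_domain D" "x \<in> D" "y \<in> D"
    and le: "\<And>p q. p \<in> ext_boundary (Some ` D) \<Longrightarrow> q \<in> ext_boundary (Some ` D) \<Longrightarrow>
      1 + abs_ratio p (Some x) q (Some y) \<le> B"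
  shows "seittenranta_metric (Some ` D) (Some x) (Some y) \<le> ln B"
proof -
  let ?S = "SUP (p, q) \<in> ext_boundary (Some ` D) \<times> ext_boundary (Some ` D). abs_ratio p (Some x) q (Some y)"
  have ne: "ext_boundary (Some ` D) \<noteq> {}"
    using ext_boundary_nonempty D(1) by blast
  then have "?S \<le> B - 1"
    using le by (intro cSUP_least) (auto simp: le_diff_eq add.commute)
  moreover have "0 \<le> ?S"
    using ne abs_ratio_le_Sup[OF D] abs_ratio_nonneg by (meson all_not_in_conv order_trans)
  ultimately show ?thesis
    unfolding seittenranta_metric_def by (intro ln_mono) auto
qed

text \<open>
  Let \<open>p\<close> be a boundary point nearest to \<open>x\<close>. The ratio is at least \<open>\<bar>x - y\<bar> / \<bar>p - x\<bar>\<close> for any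
  boundary point \<open>q\<close> that is at least as far from \<open>p\<close> as from \<open>y\<close>. If \<open>D\<close> is unbounded, infinity
  is such a \<open>q\<close>. If \<open>D\<close> is bounded, the ray that starts at \<open>y\<close> and points away from \<open>p\<close> leaves
  \<open>D\<close> at such a \<open>q\<close>.
\<close>

lemma seittenranta_metric_ge_dist_ratio:
  fixes D :: "'a::euclidean_space set"
  assumes D: "proper_domain D" and xy: "x \<in> D" "y \<in> D"
  shows "ln (1 + norm (x - y) / infdist x (frontier D))
    \<le> seittenranta_metric (Some ` D) (Some x) (Some y)"
proof -
  have o: "open D" using D by (simp add: proper_domain_def)
  obtain p where p: "p \<in> frontier D" "infdist x (frontier D) = norm (p - x)"
    using infdist_attains_inf[OF frontier_closed frontier_proper_domain_nonempty[OF D]]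
    by (metis dist_norm norm_minus_commute)
  have pb: "Some p \<in> ext_boundary (Some ` D)"
    using p o by (simp add: ext_boundary_image_Some)
  have "\<exists>q\<in>ext_boundary (Some ` D). norm (x - y) / norm (p - x) \<le> abs_ratio (Some p) (Some x) q (Some y)"
  proof (cases "bounded D")
    case False
    then have "None \<in> ext_boundary (Some ` D)"
      using o by (simp add: ext_boundary_image_Some)
    then show ?thesis by (intro bexI[of _ None]) (auto simp: abs_ratio_def)
  next
    case True
    have "p \<noteq> y"
      using p(1) xy(2) o by (auto simp: frontier_def interior_open)
    then obtain r where r: "0 < r" "y + r *\<^sub>R (y - p) \<in> frontier D"
      using ray_to_frontier[OF True, of y "y - p"] xy(2) o by (auto simp: interior_open)
    define q where "q = y + r *\<^sub>R (y - p)"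
    have "p - q = - ((1 + r) *\<^sub>R (y - p))"
      by (simp add: q_def algebra_simps)
    then have pq: "norm (p - q) = (1 + r) * norm (y - p)"
      using r(1) by simp
    have qy: "norm (q - y) = r * norm (y - p)"
      using r(1) by (simp add: q_def)
    have "norm (q - y) \<le> norm (p - q)" "0 < norm (q - y)"
      using r(1) \<open>p \<noteq> y\<close> by (auto simp: pq qy intro!: mult_right_mono)
    then have "1 * (norm (x - y) / norm (p - x)) \<le> norm (p - q) / norm (q - y) * (norm (x - y) / norm (p - x))"
      by (intro mult_right_mono) auto
    then have "norm (x - y) / norm (p - x) \<le> abs_ratio (Some p) (Some x) (Some q) (Some y)"
      by (simp add: abs_ratio_def mult.commute)
    moreover have "Some q \<in> ext_boundary (Some ` D)"
      using r(2) o by (simp add: ext_boundary_image_Some q_def)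
    ultimately show ?thesis by blast
  qed
  then obtain q where "q \<in> ext_boundary (Some ` D)"
    "norm (x - y) / norm (p - x) \<le> abs_ratio (Some p) (Some x) q (Some y)" by blast
  then show ?thesis
    unfolding p(2) by (intro seittenranta_metric_geI[OF D xy pb]) auto
qed

lemma abs_ratio_swap: "abs_ratio p x q y = abs_ratio q y p x"
proof -
  have "ext_dist r s = ext_dist s r" for r s :: "'a option"
    by (cases "(r, s)" rule: ext_dist.cases) (auto simp: norm_minus_commute)
  then show ?thesis unfolding abs_ratio_def by (metis mult.commute)
qed

lemma seittenranta_metric_commute: "seittenranta_metric G x y = seittenranta_metric G y x"
proof -
  have "(\<lambda>(p, q). abs_ratio p x q y) ` (ext_boundary G \<times> ext_boundary G) =
      (\<lambda>(p, q). abs_ratio p y q x) ` (ext_boundary G \<times> ext_boundary G)"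
    by (force simp: abs_ratio_swap[of _ x _ y])
  then show ?thesis by (simp add: seittenranta_metric_def)
qed

lemma gromov_metric_commute: "gromov_metric D x y = gromov_metric D y x"
  by (simp add: gromov_metric_def norm_minus_commute max.commute mult.commute)

section \<open>The two inequalities\<close>

lemma two_ln_divide_sqrt:
  assumes "0 < s" "0 < w"
  shows "2 * ln (s / sqrt w) = ln (s\<^sup>2 / w)"
  using assms by (simp add: ln_div ln_sqrt ln_realpow)

lemma gromov_metric_eq_ln:
  assumes "proper_domain D" "x \<in> D" "y \<in> D"
  shows "gromov_metric D x y = ln ((norm (x - y) + max (infdist x (frontier D)) (infdist y (frontier D)))\<^sup>2
    / (infdist x (frontier D) * infdist y (frontier D)))"
  unfolding gromov_metric_def
  using infdist_frontier_pos[OF assms(1,2)] infdist_frontier_pos[OF assms(1,3)]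
  by (intro two_ln_divide_sqrt) (auto intro: add_nonneg_pos simp: less_max_iff_disj)

lemma seittenranta_metric_le_gromov_metric:
  assumes D: "proper_domain D" and xy: "x \<in> D" "y \<in> D"
  shows "seittenranta_metric (Some ` D) (Some x) (Some y) \<le> gromov_metric D x y"
proof -
  define t where "t = norm (x - y)"
  define m where "m = infdist x (frontier D)"
  define k where "k = infdist y (frontier D)"
  have pos: "0 < m" "0 < k" "0 \<le> t"
    using infdist_frontier_pos[OF D] xy by (auto simp: m_def k_def t_def)
  have "seittenranta_metric (Some ` D) (Some x) (Some y) \<le> ln ((1 + t / m) * (1 + t / k))"
    using abs_ratio_le[OF D xy] unfolding t_def m_def k_def
    by (intro seittenranta_metric_leI[OF D xy])
  also have "(1 + t / m) * (1 + t / k) = (t + m) * (t + k) / (m * k)"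
    using pos by (simp add: field_simps)
  also have "ln \<dots> \<le> ln ((t + max m k)\<^sup>2 / (m * k))"
    using pos unfolding power2_eq_square
    by (intro ln_mono divide_right_mono mult_mono divide_pos_pos mult_pos_pos) auto
  also have "\<dots> = gromov_metric D x y"
    by (simp add: gromov_metric_eq_ln[OF D xy] t_def m_def k_def)
  finally show ?thesis .
qed

text \<open>
  Expanding the square leaves \<open>k/m + 2 t/m + t\<^sup>2/(m k)\<close>. Inserting the largest \<open>k\<close> in the first
  term and the smallest \<open>k\<close> in the last one bounds this by \<open>1 + 3 T + T\<^sup>2\<close> with \<open>T = t/m\<close>, which
  is at most the cube of \<open>1 + T\<close>; these two agree to first order at \<open>T = 0\<close>, which is why the
  exponent \<open>3\<close> is the right one.
\<close>

lemma gromov_quotient_le_cube: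
  fixes t m k :: real
  assumes "0 < m" "m \<le> k" "k \<le> m + t"
  shows "(t + k)\<^sup>2 / (m * k) \<le> (1 + t / m) ^ 3"
proof -
  define T where "T = t / m"
  have t: "0 \<le> t" using assms by linarith
  then have T: "0 \<le> T" using assms by (simp add: T_def)
  have "(t + k)\<^sup>2 / (m * k) = k / m + 2 * t / m + t\<^sup>2 / (m * k)"
    using assms by (simp add: field_simps power2_eq_square)
  also have "\<dots> \<le> (m + t) / m + 2 * t / m + t\<^sup>2 / (m * m)"
    using assms by (intro add_mono divide_right_mono divide_left_mono mult_left_mono) auto
  also have "\<dots> = 1 + 3 * T + T\<^sup>2"
    using assms by (simp add: T_def add_divide_distrib power2_eq_square)
  also have "\<dots> \<le> (1 + T) ^ 3"
    using T by (simp add: power2_eq_square power3_eq_cube algebra_simps)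
  finally show ?thesis by (simp add: T_def)
qed

lemma gromov_metric_le_three_seittenranta_metric:
  assumes D: "proper_domain D" and xy: "x \<in> D" "y \<in> D"
  shows "gromov_metric D x y \<le> 3 * seittenranta_metric (Some ` D) (Some x) (Some y)"
proof -
  have main: "gromov_metric D x y \<le> 3 * seittenranta_metric (Some ` D) (Some x) (Some y)"
    if xy: "x \<in> D" "y \<in> D" and le: "infdist x (frontier D) \<le> infdist y (frontier D)" for x y
  proof -
    define t where "t = norm (x - y)"
    define m where "m = infdist x (frontier D)"
    define k where "k = infdist y (frontier D)"
    have pos: "0 < m" "0 < k" "0 \<le> t" "m \<le> k"
      using infdist_frontier_pos[OF D] xy le by (auto simp: m_def k_def t_def)
    have "k \<le> m + t"
      using infdist_triangle[of y "frontier D" x]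
      by (simp add: m_def k_def t_def dist_norm norm_minus_commute)
    then have "(t + k)\<^sup>2 / (m * k) \<le> (1 + t / m) ^ 3"
      using pos by (intro gromov_quotient_le_cube)
    then have "ln ((t + k)\<^sup>2 / (m * k)) \<le> ln ((1 + t / m) ^ 3)"
      using pos by (intro ln_mono) auto
    also have "\<dots> = 3 * ln (1 + t / m)"
      using pos by (simp add: ln_realpow add_pos_nonneg)
    also have "\<dots> \<le> 3 * seittenranta_metric (Some ` D) (Some x) (Some y)"
      using seittenranta_metric_ge_dist_ratio[OF D xy] by (simp add: t_def m_def)
    finally show ?thesis
      using pos(4) by (simp add: gromov_metric_eq_ln[OF D xy] t_def m_def k_def max_def)
  qed
  show ?thesis
    using main[OF xy] main[OF xy(2,1)]
    by (metis gromov_metric_commute seittenranta_metric_commute linear)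
qed

section \<open>Sharpness in the punctured space\<close>

lemma proper_domain_punctured:
  "2 \<le> DIM('a::euclidean_space) \<Longrightarrow> proper_domain (- {0::'a})"
  using connected_punctured_universe[of "0::'a"] nonempty_Basis nonzero_Basis
  by (auto simp: proper_domain_def open_Compl)

lemma frontier_singleton: "frontier {a::'a::euclidean_space} = {a}"
  by (simp add: frontier_def)

lemma gromov_metric_punctured:
  fixes e :: "'a::euclidean_space"
  assumes "norm e = 1" "1 \<le> l"
  shows "gromov_metric (- {0}) e (l *\<^sub>R e) = 2 * ln (2 * l - 1) - ln l"
proof -
  have "e - l *\<^sub>R e = - ((l - 1) *\<^sub>R e)" by (simp add: algebra_simps)
  then have "norm (e - l *\<^sub>R e) = l - 1" using assms by simp
  then have "gromov_metric (- {0}) e (l *\<^sub>R e) = 2 * ln ((2 * l - 1) / sqrt l)"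
    using assms by (simp add: gromov_metric_def frontier_singleton max_def)
  also have "\<dots> = 2 * ln (2 * l - 1) - ln l"
    using assms by (simp add: ln_div ln_sqrt)
  finally show ?thesis .
qed

text \<open>
  The extended boundary is \<open>{0, \<infinity>}\<close>, so only four ratios compete; the largest is \<open>l - 1\<close>, for
  \<open>p = 0\<close> and \<open>q = \<infinity>\<close>.
\<close>

lemma seittenranta_metric_punctured:
  fixes e :: "'a::euclidean_space"
  assumes dim: "2 \<le> DIM('a)" and e: "norm e = 1" and l: "1 \<le> l"
  shows "seittenranta_metric (Some ` (- {0})) (Some e) (Some (l *\<^sub>R e)) = ln l"
proof (rule antisym)
  note D = proper_domain_punctured[OF dim]
  have in_D: "e \<in> - {0}" "l *\<^sub>R e \<in> - {0}"
    using e l by auto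
  have "e - l *\<^sub>R e = - ((l - 1) *\<^sub>R e)" by (simp add: algebra_simps)
  then have t: "norm (e - l *\<^sub>R e) = l - 1" using e l by simp
  show "ln l \<le> seittenranta_metric (Some ` (- {0})) (Some e) (Some (l *\<^sub>R e))"
    using seittenranta_metric_ge_dist_ratio[OF D in_D] e by (simp add: frontier_singleton t)
  have "\<not> bounded (- {0::'a})"
    using cobounded_imp_unbounded by blast
  then have bd: "ext_boundary (Some ` (- {0::'a})) = {Some 0, None}"
    by (simp add: ext_boundary_image_Some open_Compl frontier_singleton insert_commute)
  have "(l - 1) / l \<le> (l - 1) / 1"
    using l by (intro divide_left_mono) auto
  then show "seittenranta_metric (Some ` (- {0})) (Some e) (Some (l *\<^sub>R e)) \<le> ln l"
    using e l by (intro seittenranta_metric_leI[OF D in_D]) (auto simp: bd abs_ratio_def t)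
qed

text \<open>
  For large \<open>l\<close> the Gromov metric exceeds the Seittenranta metric \<open>ln l\<close> by at most the constant
  \<open>2 ln 2\<close>, which \<open>(c - 1) ln l\<close> eventually outgrows.
\<close>

lemma ex_gromov_less_mult_seittenranta:
  fixes c :: real
  assumes "1 < c"
  shows "\<exists>l>1. 2 * ln (2 * l - 1) - ln l < c * ln l"
proof -
  \<comment> \<open>chosen so that \<open>(c - 1) ln l = 2 ln 2 + (c - 1)\<close>\<close>
  define l where "l = exp (2 * ln 2 / (c - 1) + 1)"
  have l: "1 < l"
    using assms by (simp add: l_def add_nonneg_pos)
  have "2 * ln (2 * l - 1) \<le> 2 * ln (2 * l)"
    using l by simp
  also have "\<dots> = 2 * ln 2 + 2 * ln l"
    using l by (simp add: ln_mult)
  finally have "2 * ln (2 * l - 1) - ln l \<le> 2 * ln 2 + ln l" by simp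
  moreover have "(c - 1) * ln l = 2 * ln 2 + (c - 1)"
    using assms by (simp add: l_def field_simps)
  ultimately show ?thesis
    using assms l by (intro exI[of _ l]) (auto simp: algebra_simps)
qed

text \<open>
  At \<open>l = 1 + h\<close> with small \<open>h\<close> the Gromov metric is \<open>2 ln (1 + 2 h) - ln (1 + h) = 3 h + O(h\<^sup>2)\<close>,
  while the Seittenranta metric is \<open>ln (1 + h) = h + O(h\<^sup>2)\<close>.
\<close>

lemma ex_mult_seittenranta_less_gromov:
  fixes c :: real
  assumes "c < 3"
  shows "\<exists>l>1. c * ln l < 2 * ln (2 * l - 1) - ln l"
proof -
  \<comment> \<open>a nonnegative constant, so that upper bounds for \<open>ln (1 + h)\<close> may be multiplied by \<open>d + 1\<close>\<close>
  define d where "d = max c 0"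
  have d: "c \<le> d" "0 \<le> d" "d < 3" using assms by (auto simp: d_def)
  \<comment> \<open>the quadratic error \<open>8 h\<^sup>2\<close> of \<open>2 ln (1 + 2 h)\<close> is half of the gap \<open>(3 - d) h\<close>\<close>
  define h where "h = (3 - d) / 16"
  have h: "0 < h" "2 * h \<le> 1" using d by (auto simp: h_def)
  have "(d + 1) * ln (1 + h) \<le> (d + 1) * h"
    using d h by (intro mult_left_mono ln_add_one_self_le_self) auto
  also have "\<dots> < 2 * (2 * h - (2 * h)\<^sup>2)"
  proof -
    have "h * (d + 1) < h * (4 - 8 * h)"
      using h d by (intro mult_strict_left_mono) (auto simp: h_def field_simps)
    then show ?thesis by (simp add: algebra_simps power2_eq_square)
  qed
  also have "\<dots> \<le> 2 * ln (1 + 2 * h)"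
    using ln_one_plus_pos_lower_bound[of "2 * h"] h by simp
  finally have "d * ln (1 + h) < 2 * ln (2 * (1 + h) - 1) - ln (1 + h)"
    by (simp add: algebra_simps)
  moreover have "c * ln (1 + h) \<le> d * ln (1 + h)"
    using d h by (intro mult_right_mono) auto
  ultimately have "c * ln (1 + h) < 2 * ln (2 * (1 + h) - 1) - ln (1 + h)"
    by (rule le_less_trans[rotated])
  then show ?thesis
    using h by (intro exI[of _ "1 + h"]) auto
qed

theorem theorem5p2:
  assumes "CARD('n::finite) \<ge> 2"
  shows
    "(\<forall>D :: (real ^ 'n) set. proper_domain D \<longrightarrow> (\<forall>x\<in>D. \<forall>y\<in>D.
        seittenranta_metric (Some ` D) (Some x) (Some y) \<le> gromov_metric D x y \<and>
        gromov_metric D x y \<le> 3 * seittenranta_metric (Some ` D) (Some x) (Some y)))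
     \<and>
     (\<forall>c > 1. \<not> (\<forall>D :: (real ^ 'n) set. proper_domain D \<longrightarrow> (\<forall>x\<in>D. \<forall>y\<in>D.
        c * seittenranta_metric (Some ` D) (Some x) (Some y) \<le> gromov_metric D x y)))
     \<and>
     (\<forall>c < 3. \<not> (\<forall>D :: (real ^ 'n) set. proper_domain D \<longrightarrow> (\<forall>x\<in>D. \<forall>y\<in>D.
        gromov_metric D x y \<le> c * seittenranta_metric (Some ` D) (Some x) (Some y))))"
proof (intro conjI allI impI ballI)
  fix D :: "(real ^ 'n) set" and x y assume D: "proper_domain D" "x \<in> D" "y \<in> D"
  show "seittenranta_metric (Some ` D) (Some x) (Some y) \<le> gromov_metric D x y"
    by (rule seittenranta_metric_le_gromov_metric[OF D])
  show "gromov_metric D x y \<le> 3 * seittenranta_metric (Some ` D) (Some x) (Some y)"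
    by (rule gromov_metric_le_three_seittenranta_metric[OF D])
next
  have dim: "2 \<le> DIM(real ^ 'n)" using assms by simp
  note D = proper_domain_punctured[OF dim]
  obtain e :: "real ^ 'n" where e: "norm e = 1" using vector_choose_size[of 1] by auto
  have in_D: "e \<in> - {0}" "l *\<^sub>R e \<in> - {0}" if "1 < l" for l
    using e that by auto
  fix c :: real
  show "\<not> (\<forall>D :: (real ^ 'n) set. proper_domain D \<longrightarrow> (\<forall>x\<in>D. \<forall>y\<in>D.
        c * seittenranta_metric (Some ` D) (Some x) (Some y) \<le> gromov_metric D x y))" if c: "1 < c"
  proof -
    obtain l where l: "1 < l" "2 * ln (2 * l - 1) - ln l < c * ln l"
      using ex_gromov_less_mult_seittenranta[OF c] by blast
    then have "gromov_metric (- {0}) e (l *\<^sub>R e)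
        < c * seittenranta_metric (Some ` (- {0})) (Some e) (Some (l *\<^sub>R e))"
      using gromov_metric_punctured[OF e, of l] seittenranta_metric_punctured[OF dim e, of l] by simp
    then show ?thesis using D in_D[OF l(1)] by (meson not_less)
  qed
  show "\<not> (\<forall>D :: (real ^ 'n) set. proper_domain D \<longrightarrow> (\<forall>x\<in>D. \<forall>y\<in>D.
        gromov_metric D x y \<le> c * seittenranta_metric (Some ` D) (Some x) (Some y)))" if c: "c < 3"
  proof -
    obtain l where l: "1 < l" "c * ln l < 2 * ln (2 * l - 1) - ln l"
      using ex_mult_seittenranta_less_gromov[OF c] by blast
    then have "c * seittenranta_metric (Some ` (- {0})) (Some e) (Some (l *\<^sub>R e))
        < gromov_metric (- {0}) e (l *\<^sub>R e)"
      using gromov_metric_punctured[OF e, of l] seittenranta_metric_punctured[OF dim e, of l] by simp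
    then show ?thesis using D in_D[OF l(1)] by (meson not_less)
  qed
qed

end
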